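(* Let $\mathbb{F}$ be a field of characteristic different from two and let $A$ be a finite-dimensional commutative $\mathbb{F}$-algebra with squaring map $H_A\colon A\to A$, $H_A(x)=x^2$. Then $\operatorname{sr}(H_A)=\operatorname{wr}(H_A)+\dim(\operatorname{Ann}(A))$.
   Context: An algebra over a field $\mathbb{F}$ is an $\mathbb{F}$-vector space with a bilinear multiplication, not assumed associative or unital. $\operatorname{Ann}(A)=\{x\in A : xA=0\}$. A (simultaneous) Waring decomposition of length $m$ of a homogeneous quadratic map $H\colon V\to V$ on a finite-dimensional vector space $V$ is an expression $H(x)=\sum_{k=1}^m\ell_k(x)^2v_k$ with $\ell_k\in V^*$ and $v_k\in V$; its associated linear map is $L\colon V\to\mathbb{F}^m$, $L(x)=(\ell_1(x),\dots,\ell_m(x))$. The Waring rank $\operatorname{wr}(H)$ is the minimal length of a Waring decomposition of $H$, and the injective simultaneous Waring rank $\operatorname{sr}(H)$ is the minimal length of a Waring decomposition of $H$ for which $L$ is injective. *)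

theory Defs
  imports Complex_Main
begin

locale nonassoc_algebra = vector_space scale
  for scale :: "'f::field \<Rightarrow> 'a::ab_group_add \<Rightarrow> 'a" +
  fixes mult :: "'a \<Rightarrow> 'a \<Rightarrow> 'a"
  assumes linear_mult_left: "Vector_Spaces.linear scale scale (\<lambda>x. mult x y)"
    and linear_mult_right: "Vector_Spaces.linear scale scale (\<lambda>y. mult x y)"

definition Ann :: "('a::ab_group_add \<Rightarrow> 'a \<Rightarrow> 'a) \<Rightarrow> 'a set" where
  "Ann mult = {x. \<forall>a. mult x a = 0}"

definition squaring_map :: "('a \<Rightarrow> 'a \<Rightarrow> 'a) \<Rightarrow> 'a \<Rightarrow> 'a" where
  "squaring_map mult x = mult x x"

text \<open>
  Only the values of \<open>l\<close> and \<open>v\<close> at indices below \<open>m\<close> are relevant. Neither the functionals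
  \<open>l k\<close> nor the vectors \<open>v k\<close> are required to be nonzero or distinct.
\<close>
definition waring_decomposition ::
  "('f::field \<Rightarrow> 'a::ab_group_add \<Rightarrow> 'a) \<Rightarrow> ('a \<Rightarrow> 'a) \<Rightarrow> nat \<Rightarrow> (nat \<Rightarrow> 'a \<Rightarrow> 'f) \<Rightarrow> (nat \<Rightarrow> 'a) \<Rightarrow> bool"
  where
  "waring_decomposition scale H m l v \<longleftrightarrow>
     (\<forall>k<m. Vector_Spaces.linear scale (*) (l k)) \<and>
     (\<forall>x. H x = (\<Sum>k<m. scale ((l k x)\<^sup>2) (v k)))"

text \<open>The space \<open>F\<^sup>m\<close> is represented by the lists of length \<open>m\<close>.\<close>
definition assoc_map :: "nat \<Rightarrow> (nat \<Rightarrow> 'a \<Rightarrow> 'f) \<Rightarrow> 'a \<Rightarrow> 'f list" where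
  "assoc_map m l x = map (\<lambda>k. l k x) [0..<m]"

text \<open>
  The two ranks are meant for homogeneous quadratic maps on a finite-dimensional space in
  characteristic different from two. There polarization yields a decomposition, and padding it with
  zero vectors \<open>v k\<close> an injective one, so both minima are taken over nonempty sets.
\<close>
definition waring_rank ::
  "('f::field \<Rightarrow> 'a::ab_group_add \<Rightarrow> 'a) \<Rightarrow> ('a \<Rightarrow> 'a) \<Rightarrow> nat" where
  "waring_rank scale H = (LEAST m. \<exists>l v. waring_decomposition scale H m l v)"

definition inj_waring_rank ::
  "('f::field \<Rightarrow> 'a::ab_group_add \<Rightarrow> 'a) \<Rightarrow> ('a \<Rightarrow> 'a) \<Rightarrow> nat" where
  "inj_waring_rank scale H =
     (LEAST m. \<exists>l v. waring_decomposition scale H m l v \<and> inj (assoc_map m l))"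

end

theory Submission
  imports Defs
begin

text \<open>
  If \<open>x \<in> ker L\<close>, then \<open>H (x + y) = H y\<close> for all \<open>y\<close>, so \<open>2 x y = 0\<close>; hence
  \<open>ker L \<subseteq> Ann A\<close> for every decomposition, and adding \<open>dim (Ann A)\<close> functionals that separate the
  points of \<open>Ann A\<close>, with coefficient vectors \<open>0\<close>, makes any decomposition injective. Conversely,
  \<open>H\<close> is constant on the cosets of \<open>Ann A\<close>. If \<open>L\<close> is injective, one can choose \<open>dim (Ann A)\<close>
  indices and a linear representative map \<open>g\<close> for these cosets such that the chosen
  functionals vanish on the image of \<open>g\<close>; then the remaining terms of \<open>H (g x) = H x\<close> form a
  decomposition.
\<close>

section \<open>Preliminaries on the characteristic, injectivity and index sets\<close>

lemma two_neq_zero_if_CHAR_neq_2: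
  assumes "CHAR('f::field) \<noteq> 2"
  shows "(2::'f) \<noteq> 0"
proof
  assume "(2::'f) = 0"
  then have "of_nat 2 = (0::'f)"
    by simp
  then have "CHAR('f) dvd 2"
    by (simp only: of_nat_eq_0_iff_char_dvd)
  then have "CHAR('f) \<le> 2" "CHAR('f) \<noteq> 0"
    by (auto dest: dvd_imp_le intro: Nat.gr0I)
  with assms have "CHAR('f) = 1"
    by linarith
  then show False
    using CHAR_not_1 [where 'a = 'f] by simp
qed

lemma vector_space_field: "vector_space ((*) :: 'f::field \<Rightarrow> 'f \<Rightarrow> 'f)"
  by unfold_locales (simp_all add: algebra_simps)

text \<open>Differences are compared coordinatewise, since lists carry no vector space structure
  here. Afterwards injectivity enters only through the common kernel of the
  \<open>l k\<close>.\<close>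

lemma inj_assoc_map_iff:
  assumes "\<And>k. k < m \<Longrightarrow> Vector_Spaces.linear scale (*) (l k)"
  shows "inj (assoc_map m l) \<longleftrightarrow> (\<forall>x. (\<forall>k<m. l k x = 0) \<longrightarrow> x = 0)"
proof -
  have diff: "l k (x - y) = l k x - l k y" and zero: "l k 0 = 0" if "k < m" for k x y
    using module_hom.diff module_hom.zero module_hom_linearI [OF assms [OF that]] by metis+
  have eq: "assoc_map m l x = assoc_map m l y \<longleftrightarrow> (\<forall>k<m. l k (x - y) = 0)" for x y
    by (auto simp: assoc_map_def diff)
  show ?thesis
  proof
    assume "inj (assoc_map m l)"
    then show "\<forall>x. (\<forall>k<m. l k x = 0) \<longrightarrow> x = 0"
      using eq [of _ 0] by (auto dest: injD)
  next
    assume "\<forall>x. (\<forall>k<m. l k x = 0) \<longrightarrow> x = 0"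
    then show "inj (assoc_map m l)"
      by (metis eq injI right_minus_eq)
  qed
qed

text \<open>Frees the index set: it is applied to triples of two basis vectors and a sign, and to a
  set of surviving indices.\<close>

lemma waring_decomposition_finite_index:
  assumes "finite I" "\<And>i. i \<in> I \<Longrightarrow> Vector_Spaces.linear scale (*) (l i)"
    and "\<And>x. H x = (\<Sum>i\<in>I. scale ((l i x)\<^sup>2) (v i))"
  shows "\<exists>l' v'. waring_decomposition scale H (card I) l' v'"
proof -
  obtain h where h: "bij_betw h {..<card I} I"
    using ex_bij_betw_nat_finite [OF assms(1)] by (auto simp: lessThan_atLeast0)
  have "waring_decomposition scale H (card I) (l \<circ> h) (v \<circ> h)"
    unfolding waring_decomposition_def
    using assms(2) bij_betwE [OF h]
    by (auto simp: assms(3) sum.reindex_bij_betw [OF h, symmetric])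
  then show ?thesis
    by blast
qed

lemma waring_decomposition_append_zeros:
  assumes "waring_decomposition scale H m l v" "vector_space scale"
    and "\<And>k. k < d \<Longrightarrow> Vector_Spaces.linear scale (*) (f k)"
  shows "waring_decomposition scale H (m + d)
    (\<lambda>k. if k < m then l k else f (k - m)) (\<lambda>k. if k < m then v k else 0)"
proof -
  interpret vector_space scale
    by (fact assms(2))
  have "(\<Sum>k<m + d. scale (((if k < m then l k else f (k - m)) x)\<^sup>2) (if k < m then v k else 0)) =
      (\<Sum>k<m. scale ((l k x)\<^sup>2) (v k))" for x
    by (rule sum.mono_neutral_cong_right) auto
  then show ?thesis
    using assms by (auto simp: waring_decomposition_def)
qed

section \<open>Linear functionals on a subspace\<close>

context finite_dimensional_vector_space
begin

text \<open>If \<open>f w\<close> is nonzero for some \<open>w\<close> in \<open>W\<close>,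
  subtracting a suitable multiple of \<open>w\<close> moves any element of \<open>W\<close> into the
  kernel, so \<open>w\<close> and the kernel span \<open>W\<close>.\<close>

lemma dim_le_dim_kernel_Suc:
  assumes f: "Vector_Spaces.linear scale (*) f" and W: "subspace W"
  shows "dim W \<le> dim {x \<in> W. f x = 0} + 1"
proof (cases "\<forall>w\<in>W. f w = 0")
  case True
  then have "{x \<in> W. f x = 0} = W"
    by auto
  then show ?thesis
    by simp
next
  case False
  then obtain w where w: "w \<in> W" "f w \<noteq> 0"
    by blast
  interpret f: Vector_Spaces.linear scale "(*)" f
    by (fact f)
  have "W \<subseteq> span (insert w {x \<in> W. f x = 0})"
  proof
    fix x
    assume x: "x \<in> W"
    have "x - scale (f x / f w) w \<in> {x \<in> W. f x = 0}"
      using w x W by (auto simp: f.diff f.scale subspace_diff subspace_scale)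
    then show "x \<in> span (insert w {x \<in> W. f x = 0})"
      unfolding span_breakdown_eq by (blast intro: span_base)
  qed
  then have "dim W \<le> dim (insert w {x \<in> W. f x = 0})"
    by (metis dim_span dim_subset)
  also have "\<dots> \<le> dim {x \<in> W. f x = 0} + 1"
    by (simp add: dim_insert)
  finally show ?thesis .
qed

text \<open>The indices outside \<open>T\<close>, at least \<open>dim W\<close> many, are those
  whose functionals vanish on the representatives \<open>g x\<close> of the cosets of
  \<open>W\<close>. Induction on \<open>S\<close>: if \<open>l k\<close> vanishes on
  \<open>W\<close>, the other functionals still separate \<open>W\<close>, and \<open>k\<close>
  joins \<open>T\<close>. Otherwise \<open>W\<close> shrinks to the kernel of \<open>l k\<close> in
  \<open>W\<close>, losing at most one dimension, and \<open>k\<close> stays outside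
  \<open>T\<close>.\<close>

lemma ex_linear_representatives:
  assumes "finite S" "subspace W" "\<And>k. k \<in> S \<Longrightarrow> Vector_Spaces.linear scale (*) (l k)"
    and "\<And>w. w \<in> W \<Longrightarrow> (\<And>k. k \<in> S \<Longrightarrow> l k w = 0) \<Longrightarrow> w = 0"
  shows "\<exists>T g. T \<subseteq> S \<and> card T + dim W \<le> card S \<and> Vector_Spaces.linear scale scale g \<and>
    (\<forall>x. g x - x \<in> W) \<and> (\<forall>k\<in>S - T. \<forall>x. l k (g x) = 0)"
  using assms
proof (induction S arbitrary: W rule: finite_induct)
  case empty
  \<comment> \<open>With no functionals left, the separation hypothesis holds only for the zero
    subspace, and the identity serves as \<open>g\<close>.\<close>
  then have "W = {0}"
    using subspace_0 by auto
  then show ?case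
    using linear_ident by (intro exI [of _ "{}"] exI [of _ "\<lambda>x. x"]) auto
next
  case (insert k S)
  interpret l: Vector_Spaces.linear scale "(*)" "l k"
    using insert.prems(2) by simp
  show ?case
  proof (cases "\<forall>w\<in>W. l k w = 0")
    case True
    have "\<exists>T g. T \<subseteq> S \<and> card T + dim W \<le> card S \<and> Vector_Spaces.linear scale scale g \<and>
        (\<forall>x. g x - x \<in> W) \<and> (\<forall>j\<in>S - T. \<forall>x. l j (g x) = 0)"
      using insert.prems True by (intro insert.IH) auto
    then obtain T g where Tg: "T \<subseteq> S" "card T + dim W \<le> card S"
        "Vector_Spaces.linear scale scale g" "\<forall>x. g x - x \<in> W" "\<forall>j\<in>S - T. \<forall>x. l j (g x) = 0"
      by blast
    have "card (insert k T) + dim W \<le> card (insert k S)"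
      using Tg(1,2) insert.hyps finite_subset [OF Tg(1)] by (auto simp: card_insert_if)
    then show ?thesis
      using Tg by (intro exI [of _ "insert k T"] exI [of _ g]) auto
  next
    case False
    then obtain w where w: "w \<in> W" "l k w \<noteq> 0"
      by blast
    define W' where "W' = {x \<in> W. l k x = 0}"
    have W': "subspace W'"
      using insert.prems(1) by (auto simp: W'_def subspace_def l.add l.scale)
    have "\<exists>T g. T \<subseteq> S \<and> card T + dim W' \<le> card S \<and> Vector_Spaces.linear scale scale g \<and>
        (\<forall>x. g x - x \<in> W') \<and> (\<forall>j\<in>S - T. \<forall>x. l j (g x) = 0)"
      using insert.prems W' by (intro insert.IH) (auto simp: W'_def)
    then obtain T g where Tg: "T \<subseteq> S" "card T + dim W' \<le> card S"
        "Vector_Spaces.linear scale scale g" "\<forall>x. g x - x \<in> W'" "\<forall>j\<in>S - T. \<forall>x. l j (g x) = 0"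
      by blast
    \<comment> \<open>The projection onto the kernel of \<open>l k\<close> along \<open>w\<close>.
      It moves points only by multiples of \<open>w\<close>, hence within cosets of
      \<open>W\<close>.\<close>
    define p where "p x = x - scale (l k x / l k w) w" for x
    have p: "Vector_Spaces.linear scale scale p"
      unfolding Vector_Spaces.linear_iff p_def
      by (simp add: vector_space_axioms l.add l.scale add_divide_distrib scale_left_distrib
        scale_right_diff_distrib)
    have kp: "l k (p x) = 0" for x
      using w by (simp add: p_def l.diff l.scale)
    \<comment> \<open>\<open>g\<close> moves points only within cosets of \<open>W'\<close>, on
      which \<open>l k\<close> vanishes, so \<open>g\<close> does not undo the effect of
      \<open>p\<close>.\<close>
    have kgp: "l k (g (p x)) = 0" for x
    proof -
      have "l k (g (p x) - p x) = 0"
        using Tg(4) by (auto simp: W'_def)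
      then show ?thesis
        by (simp add: l.diff kp)
    qed
    have "g (p x) - x \<in> W" for x
    proof -
      have "g (p x) - p x \<in> W"
        using Tg(4) by (auto simp: W'_def)
      moreover have "scale (l k x / l k w) w \<in> W"
        using w insert.prems(1) by (simp add: subspace_scale)
      ultimately have "(g (p x) - p x) - scale (l k x / l k w) w \<in> W"
        using insert.prems(1) by (rule_tac subspace_diff)
      then show ?thesis
        by (simp add: p_def)
    qed
    moreover have "card T + dim W \<le> card (insert k S)"
      using Tg(2) insert.hyps dim_le_dim_kernel_Suc [OF l.linear_axioms insert.prems(1)]
      by (simp add: W'_def)
    ultimately show ?thesis
      using Tg kgp Vector_Spaces.linear_compose [OF p Tg(3), unfolded o_def]
      by (intro exI [of _ T] exI [of _ "\<lambda>x. g (p x)"]) auto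
  qed
qed

text \<open>Coordinates with respect to a basis of \<open>W\<close> separate its points. Extending
  the basis to the whole space makes them functionals defined everywhere, with unchanged values on
  \<open>W\<close>.\<close>

lemma ex_separating_functionals:
  "\<exists>f :: nat \<Rightarrow> 'b \<Rightarrow> 'a. (\<forall>k<dim W. Vector_Spaces.linear scale (*) (f k)) \<and>
    (\<forall>x\<in>W. (\<forall>k<dim W. f k x = 0) \<longrightarrow> x = 0)"
proof -
  obtain B where B: "B \<subseteq> W" "independent B" "W \<subseteq> span B" "card B = dim W"
    by (rule basis_exists)
  obtain h where h: "bij_betw h {..<dim W} B"
    using ex_bij_betw_nat_finite [OF finiteI_independent [OF B(2)]] B(4)
    by (auto simp: lessThan_atLeast0)
  define r where "r = representation (extend_basis B)"
  have "Vector_Spaces.linear scale (*) (\<lambda>x. r x b)" for b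
    unfolding r_def by (intro linear_representation independent_extend_basis span_extend_basis B)
  moreover have "x = 0" if x: "x \<in> W" "\<forall>k<dim W. r x (h k) = 0" for x
  proof -
    have xB: "x \<in> span B"
      using x B by blast
    then have r: "r x = representation B x"
      unfolding r_def
      by (intro representation_extend independent_extend_basis extend_basis_superset B)
    have "representation B x b = 0" for b
    proof (cases "b \<in> B")
      case True
      then show ?thesis
        using x(2) h by (auto simp: bij_betw_def r)
    next
      case False
      then show ?thesis
        using representation_ne_zero by blast
    qed
    then show ?thesis
      using sum_nonzero_representation_eq [OF B(2) xB] by simp
  qed
  ultimately show ?thesis
    by (intro exI [of _ "\<lambda>k x. r x (h k)"]) auto
qed

end

section \<open>Waring decompositions of the squaring map\<close>

locale finite_dim_comm_algebra =
  finite_dimensional_vector_space scale Basis + nonassoc_algebra scale mult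
  for scale :: "'f::field \<Rightarrow> 'a::ab_group_add \<Rightarrow> 'a" and Basis mult +
  assumes comm: "mult x y = mult y x"
    and char: "(2::'f) \<noteq> 0"
begin

abbreviation "H \<equiv> squaring_map mult"

sublocale left: Vector_Spaces.linear scale scale "\<lambda>x. mult x y" for y
  by (rule linear_mult_left)

sublocale right: Vector_Spaces.linear scale scale "\<lambda>y. mult x y" for x
  by (rule linear_mult_right)

lemma subspace_Ann: "subspace (Ann mult)"
  by (auto simp: Ann_def subspace_def left.add left.scale left.zero)

lemma squaring_map_add_Ann:
  assumes "a \<in> Ann mult"
  shows "H (x + a) = H x"
  using assms comm [of x a] by (simp add: squaring_map_def Ann_def left.add right.add)

text \<open>Ensures that the minimum defining the Waring rank is attained. After expanding
  \<open>x\<close> in the basis, each product of two coordinates is written as a difference of two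
  squares.\<close>

lemma ex_waring_decomposition: "\<exists>m l v. waring_decomposition scale H m l v"
proof -
  let ?r = "representation Basis"
  \<comment> \<open>The flag \<open>s\<close> selects the half sum or the half difference of two
    coordinates; the sign of the square is carried by \<open>v\<close>.\<close>
  define l where "l = (\<lambda>(b, c, s) x. (if s then ?r x b + ?r x c else ?r x b - ?r x c) / 2)"
  define v where "v = (\<lambda>(b, c, s). if s then mult b c else - mult b c)"
  let ?I = "Basis \<times> Basis \<times> (UNIV :: bool set)"
  have r: "Vector_Spaces.linear scale (*) (\<lambda>x. ?r x b)" for b
    by (intro linear_representation independent_Basis span_Basis)
  have r_add: "?r (x + y) b = ?r x b + ?r y b" and r_scale: "?r (scale c x) b = c * ?r x b"
    for x y b c
    using r [of b] by (auto simp: Vector_Spaces.linear_iff)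
  have lin: "Vector_Spaces.linear scale (*) (l i)" for i
    by (cases i)
      (simp add: l_def Vector_Spaces.linear_iff vector_space_axioms vector_space_field r_add r_scale
        add_divide_distrib diff_divide_distrib distrib_left right_diff_distrib)
  have expand: "x = (\<Sum>b\<in>Basis. scale (?r x b) b)" for x
    using sum_representation_eq [OF independent_Basis, of x Basis]
    by (simp add: span_Basis finite_Basis)
  have polar: "(\<Sum>s\<in>UNIV. scale ((l (b, c, s) x)\<^sup>2) (v (b, c, s))) =
      scale (?r x b * ?r x c) (mult b c)"
    for b c x
  proof -
    \<comment> \<open>Halving first confines division by 2 to the two coordinates; what remains is
      an identity valid in any commutative ring.\<close>
    define s t where "s = ?r x b / 2" and "t = ?r x c / 2"
    then have "?r x b = s + s" "?r x c = t + t"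
      using char by (simp_all flip: mult_2_right)
    moreover have "(s + t)\<^sup>2 - (s - t)\<^sup>2 = (s + s) * (t + t)"
      by (simp add: algebra_simps power2_eq_square)
    ultimately have "((?r x b + ?r x c) / 2)\<^sup>2 - ((?r x b - ?r x c) / 2)\<^sup>2 = ?r x b * ?r x c"
      by (simp add: add_divide_distrib diff_divide_distrib s_def t_def)
    then show ?thesis
      by (simp add: UNIV_bool l_def v_def scale_minus_right flip: scale_left_diff_distrib)
  qed
  have "H x = (\<Sum>i\<in>?I. scale ((l i x)\<^sup>2) (v i))" for x
  proof -
    have "H x = mult (\<Sum>b\<in>Basis. scale (?r x b) b) (\<Sum>c\<in>Basis. scale (?r x c) c)"
      using expand [of x] by (simp add: squaring_map_def)
    also have "\<dots> = (\<Sum>b\<in>Basis. \<Sum>c\<in>Basis. scale (?r x b * ?r x c) (mult b c))"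
      by (simp add: left.sum right.sum left.scale right.scale scale_sum_right comm mult.commute)
    also have "\<dots> = (\<Sum>i\<in>?I. scale ((l i x)\<^sup>2) (v i))"
      by (simp add: polar [symmetric] sum.cartesian_product')
    finally show ?thesis .
  qed
  moreover have "finite ?I"
    using finite_Basis by simp
  ultimately show ?thesis
    by (intro exI [of _ "card ?I"] waring_decomposition_finite_index [where l = l and v = v] lin)
qed

lemma kernel_subset_Ann:
  assumes "waring_decomposition scale H m l v" "\<And>k. k < m \<Longrightarrow> l k x = 0"
  shows "x \<in> Ann mult"
proof -
  have H: "H y = (\<Sum>k<m. scale ((l k y)\<^sup>2) (v k))" for y
    using assms(1) by (simp add: waring_decomposition_def)
  have add: "l k (x + y) = l k y" if "k < m" for k y
    using assms that by (simp add: waring_decomposition_def Vector_Spaces.linear_iff)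
  have "mult x y = 0" for y
  proof -
    \<comment> \<open>The second equation removes the square of \<open>x\<close> from the expansion
      of the first, leaving only the doubled product.\<close>
    have "H (x + y) = H y" "H x = 0"
      using assms(2) by (simp_all add: H add)
    then have "mult x y + mult x y = 0"
      using comm [of y x] by (simp add: squaring_map_def left.add right.add)
    then have "scale 2 (mult x y) = 0"
      using scale_left_distrib [of 1 1 "mult x y"] by simp
    then show ?thesis
      using char by simp
  qed
  then show ?thesis
    by (simp add: Ann_def)
qed

lemma ex_injective_waring_decomposition:
  assumes dec: "waring_decomposition scale H m l v"
  shows "\<exists>l' v'. waring_decomposition scale H (m + dim (Ann mult)) l' v' \<and>
    inj (assoc_map (m + dim (Ann mult)) l')"
proof -
  obtain f where f: "\<And>k. k < dim (Ann mult) \<Longrightarrow> Vector_Spaces.linear scale (*) (f k)"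
    and sep: "\<And>x. x \<in> Ann mult \<Longrightarrow> (\<And>k. k < dim (Ann mult) \<Longrightarrow> f k x = 0) \<Longrightarrow> x = 0"
    using ex_separating_functionals [of "Ann mult"] by blast
  let ?l = "\<lambda>k. if k < m then l k else f (k - m)"
  let ?v = "\<lambda>k. if k < m then v k else 0"
  have dec': "waring_decomposition scale H (m + dim (Ann mult)) ?l ?v"
    by (intro waring_decomposition_append_zeros dec vector_space_axioms f)
  \<comment> \<open>The first \<open>m\<close> functionals place \<open>x\<close> in
    \<open>Ann mult\<close>; there the appended ones force it to be zero.\<close>
  have "x = 0" if x: "\<forall>k<m + dim (Ann mult). ?l k x = 0" for x
  proof (rule sep)
    have "l k x = 0" if "k < m" for k
      using x [rule_format, of k] that by simp
    then show "x \<in> Ann mult"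
      by (rule kernel_subset_Ann [OF dec])
    show "f k x = 0" if "k < dim (Ann mult)" for k
      using x [rule_format, of "m + k"] that by simp
  qed
  then have "inj (assoc_map (m + dim (Ann mult)) ?l)"
    using dec' by (subst inj_assoc_map_iff) (auto simp: waring_decomposition_def)
  with dec' show ?thesis
    by blast
qed

lemma waring_rank_add_dim_Ann_le:
  assumes dec: "waring_decomposition scale H m l v" and inj: "inj (assoc_map m l)"
  shows "waring_rank scale H + dim (Ann mult) \<le> m"
proof -
  have lin: "\<And>k. k < m \<Longrightarrow> Vector_Spaces.linear scale (*) (l k)"
    and H: "\<And>x. H x = (\<Sum>k<m. scale ((l k x)\<^sup>2) (v k))"
    using dec by (auto simp: waring_decomposition_def)
  \<comment> \<open>Injectivity makes the \<open>l k\<close> separate the whole space, in particular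
    \<open>Ann mult\<close>, which takes the role of \<open>W\<close>.\<close>
  have "\<exists>T g. T \<subseteq> {..<m} \<and> card T + dim (Ann mult) \<le> card {..<m} \<and>
      Vector_Spaces.linear scale scale g \<and> (\<forall>x. g x - x \<in> Ann mult) \<and>
      (\<forall>k\<in>{..<m} - T. \<forall>x. l k (g x) = 0)"
    using inj lin
    by (intro ex_linear_representatives subspace_Ann) (auto simp: inj_assoc_map_iff [OF lin])
  then obtain T g where Tg: "T \<subseteq> {..<m}" "card T + dim (Ann mult) \<le> m"
      "Vector_Spaces.linear scale scale g" "\<And>x. g x - x \<in> Ann mult"
      "\<And>k x. k < m \<Longrightarrow> k \<notin> T \<Longrightarrow> l k (g x) = 0"
    by auto
  have "H x = (\<Sum>k\<in>T. scale (((l k \<circ> g) x)\<^sup>2) (v k))" for x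
  proof -
    \<comment> \<open>Replacing \<open>x\<close> by \<open>g x\<close> keeps the square and kills
      every term outside \<open>T\<close>, so the \<open>l k \<circ> g\<close> with \<open>k\<close>
      in \<open>T\<close> suffice.\<close>
    have "H x = H (g x)"
      using squaring_map_add_Ann [OF Tg(4), of x x] by simp
    also have "\<dots> = (\<Sum>k\<in>T. scale (((l k \<circ> g) x)\<^sup>2) (v k))"
      unfolding H using Tg by (intro sum.mono_neutral_cong_right) auto
    finally show ?thesis .
  qed
  moreover have "finite T"
    using Tg(1) finite_subset by blast
  moreover have "Vector_Spaces.linear scale (*) (l k \<circ> g)" if "k \<in> T" for k
    using Tg(1) that by (intro Vector_Spaces.linear_compose [OF Tg(3)] lin) auto
  ultimately have "\<exists>l' v'. waring_decomposition scale H (card T) l' v'"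
    by (intro waring_decomposition_finite_index)
  then have "waring_rank scale H \<le> card T"
    unfolding waring_rank_def by (rule Least_le)
  with Tg(2) show ?thesis
    by simp
qed

lemma inj_waring_rank_eq:
  "inj_waring_rank scale H = waring_rank scale H + dim (Ann mult)"
proof (rule antisym)
  obtain l v where "waring_decomposition scale H (waring_rank scale H) l v"
    unfolding waring_rank_def using LeastI_ex [OF ex_waring_decomposition] by blast
  from ex_injective_waring_decomposition [OF this]
  have ex: "\<exists>l v. waring_decomposition scale H (waring_rank scale H + dim (Ann mult)) l v \<and>
      inj (assoc_map (waring_rank scale H + dim (Ann mult)) l)" .
  then show "inj_waring_rank scale H \<le> waring_rank scale H + dim (Ann mult)"
    unfolding inj_waring_rank_def by (rule Least_le)
  \<comment> \<open>The decomposition just found also shows that the injective minimum is attained,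
    so the lower bound applies at that length.\<close>
  from ex have "\<exists>l v. waring_decomposition scale H (inj_waring_rank scale H) l v \<and>
      inj (assoc_map (inj_waring_rank scale H) l)"
    unfolding inj_waring_rank_def by (rule LeastI)
  then show "waring_rank scale H + dim (Ann mult) \<le> inj_waring_rank scale H"
    using waring_rank_add_dim_Ann_le by blast
qed

end

theorem corollary4p6:
  fixes scale :: "'f::field \<Rightarrow> 'a::ab_group_add \<Rightarrow> 'a"
    and Basis :: "'a set"
    and mult :: "'a \<Rightarrow> 'a \<Rightarrow> 'a"
  assumes "CHAR('f) \<noteq> 2"
    and "finite_dimensional_vector_space scale Basis"
    and "nonassoc_algebra scale mult"
    and "\<And>x y. mult x y = mult y x"
  shows "inj_waring_rank scale (squaring_map mult) =
         waring_rank scale (squaring_map mult) + vector_space.dim scale (Ann mult)"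
proof -
  interpret finite_dim_comm_algebra scale Basis mult
    using assms two_neq_zero_if_CHAR_neq_2 [OF assms(1)]
    by (intro finite_dim_comm_algebra.intro finite_dim_comm_algebra_axioms.intro)
  show ?thesis
    by (rule inj_waring_rank_eq)
qed

end
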